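(* (Detectors and truth-induction rates.) Set $\Delta_0^R=\Delta_1^R$. Then, within the prior probability regimes that feature unique PBNE (i.e., the Zero-Heavy, Middle, and One-Heavy regimes), for all $J\in[0,1]$ (with $(J,G)$ a feasible detector, $0<J\le 1-|G|$) and all $p\in[0,1]$, the truth-induction rate $\tau$ satisfies $$\tau(J,G,p)\le\tfrac12\ \text{ for } G\in(-1,0],\qquad \tau(J,G,p)\ge\tfrac12\ \text{ for } G\in[0,1).$$
   Context: Cheap-talk signaling game with evidence. Players: a sender $S$ and a receiver $R$. The type $\theta\in\{0,1\}$ is drawn with prior $p(1)=p$, $p(0)=1-p$. Knowing $\theta$, $S$ sends $m\in\{0,1\}$ according to a mixed strategy $\sigma^S(m\,|\,\theta)$. A detector then emits evidence $e\in\{0,1\}$ with probability $\lambda(e\,|\,\theta,m)$, where $\lambda(1\,|\,\theta,m)=\beta$ if $m\ne\theta$ and $\lambda(1\,|\,\theta,m)=\alpha$ if $m=\theta$ (and $\lambda(0\,|\,\theta,m)=1-\lambda(1\,|\,\theta,m)$), with $0\le\alpha<\beta\le1$. $R$ observes $(m,e)$ (not $\theta$) and plays $a\in\{0,1\}$ according to a mixed strategy $\sigma^R(a\,|\,m,e)$. Utilities $u^S(\theta,m,a),u^R(\theta,m,a)\in\mathbb{R}$ satisfy: neither depends on $m$; $u^R(0,m,0)>u^R(0,m,1)$ and $u^R(1,m,1)>u^R(1,m,0)$; $u^S(0,m,0)<u^S(0,m,1)$ and $u^S(1,m,0)>u^S(1,m,1)$. Put $\Delta_0^R=u^R(0,m,0)-u^R(0,m,1)>0$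 and $\Delta_1^R=u^R(1,m,1)-u^R(1,m,0)>0$. A perfect Bayesian Nash equilibrium (PBNE) is a triple $(\sigma^{S*},\sigma^{R*},\mu^R)$, with $\mu^R(\cdot\,|\,m,e)$ a probability distribution on $\{0,1\}$ for each $(m,e)$, such that: (1) for each $\theta$, $\sigma^{S*}$ maximizes over $\sigma^S$ the quantity $\sum_{a,e,m}\sigma^{R*}(a\,|\,m,e)\lambda(e\,|\,\theta,m)\sigma^S(m\,|\,\theta)u^S(\theta,m,a)$; (2) for each $(m,e)$, $\sigma^{R*}$ maximizes over $\sigma^R$ the quantity $\sum_\theta\mu^R(\theta\,|\,m,e)\sum_a\sigma^R(a\,|\,m,e)u^R(\theta,m,a)$; (3) whenever $\sum_{\tilde\theta}\lambda(e\,|\,\tilde\theta,m)\sigma^{S*}(m\,|\,\tilde\theta)p(\tilde\theta)>0$, $\mu^R(\theta\,|\,m,e)$ is given by Bayes' law, $\lambda(e\,|\,\theta,m)\sigma^{S*}(m\,|\,\theta)p(\theta)/\sum_{\tilde\theta}\lambda(e\,|\,\tilde\theta,m)\sigma^{S*}(m\,|\,\tilde\theta)p(\tilde\theta)$; otherwise $\mu^R(\cdot\,|\,m,e)$ is arbitrary. Detector quality is $J=\beta-\alpha$ and aggressiveness is $G=\beta-(1-\alpha)$, so that $\alpha=(1+G-J)/2$ and $\beta=(1+G+J)/2$. Put $$T_1=\frac{\alpha\Delta_0^R}{\alpha\Delta_0^R+\beta\Delta_1^R},\quad T_2=\frac{(1-\beta)\Delta_0^R}{(1-\beta)\Delta_0^R+(1-\alpha)\Delta_1^R},\quad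 T_3=\frac{(1-\alpha)\Delta_0^R}{(1-\alpha)\Delta_0^R+(1-\beta)\Delta_1^R},\quad T_4=\frac{\beta\Delta_0^R}{\beta\Delta_0^R+\alpha\Delta_1^R}.$$ Prior probability regimes: for $G\le0$, Zero-Heavy is $T_1<p<T_2$, Middle is $T_2<p<T_3$, One-Heavy is $T_3<p<T_4$; for $G\ge0$, Zero-Heavy is $T_2<p<T_1$, Middle is $T_1<p<T_4$, One-Heavy is $T_4<p<T_3$. (For $G=0$ one has $T_1=T_2$ and $T_3=T_4$, so the two definitions agree and the Heavy regimes are empty.) Let $\sigma^{S*}(m\,|\,\theta;p)$ denote the sender's equilibrium (PBNE) strategy when the prior is $p=p(1)$. The truth-induction rate of the detector $(J,G)$ at the prior $p$ is $$\tau(J,G,p)=\sum_{\theta\in\{0,1\}}p(\theta)\,\sigma^{S*}(m=\theta\,|\,\theta;p),$$ the proportion of messages sent by $S$ for which $m=\theta$.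
   Formalization: PBNE is not unique as claimed: in the Heavy regimes τ is taken at the equilibrium unique among pure sender strategies (pooling), as some mixed PBNE violate the bound; at G=0 a unique equilibrium is assumed, but none exists, so nothing is claimed there. *)

theory Defs
  imports Complex_Main
begin

text \<open>
  Types, messages, evidence and actions range over \<^typ>\<open>bool\<close>, where \<^term>\<open>True\<close> stands for 1 and
  \<^term>\<open>False\<close> for 0. Conditional distributions are curried functions with the conditioning
  variables first: \<open>\<sigma>S \<theta> m\<close> is the probability of message \<open>m\<close> given type \<open>\<theta>\<close>,
  \<open>\<sigma>R m e a\<close> that of action \<open>a\<close> given \<open>(m, e)\<close>, and \<open>\<mu> m e \<theta>\<close> is the belief in type \<open>\<theta>\<close> given
  \<open>(m, e)\<close>. A number \<open>p\<close> is the prior probability of type 1.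
\<close>

definition is_dist :: "(bool \<Rightarrow> real) \<Rightarrow> bool" where
  "is_dist d \<longleftrightarrow> (\<forall>x. 0 \<le> d x) \<and> (\<Sum>x\<in>UNIV. d x) = 1"

definition prior :: "real \<Rightarrow> bool \<Rightarrow> real" where
  "prior p \<theta> = (if \<theta> then p else 1 - p)"

definition detector :: "real \<Rightarrow> real \<Rightarrow> bool \<Rightarrow> bool \<Rightarrow> bool \<Rightarrow> real" where
  "detector \<alpha> \<beta> \<theta> m e =
     (let l = (if m \<noteq> \<theta> then \<beta> else \<alpha>) in if e then l else 1 - l)"

definition deception_utilities ::
  "(bool \<Rightarrow> bool \<Rightarrow> bool \<Rightarrow> real) \<Rightarrow> (bool \<Rightarrow> bool \<Rightarrow> bool \<Rightarrow> real) \<Rightarrow> bool" where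
  "deception_utilities uS uR \<longleftrightarrow>
     (\<forall>\<theta> m m' a. uS \<theta> m a = uS \<theta> m' a) \<and>
     (\<forall>\<theta> m m' a. uR \<theta> m a = uR \<theta> m' a) \<and>
     (\<forall>m. uR False m False > uR False m True) \<and>
     (\<forall>m. uR True m True > uR True m False) \<and>
     (\<forall>m. uS False m False < uS False m True) \<and>
     (\<forall>m. uS True m False > uS True m True)"

text \<open>The message argument below is a dummy, since the utilities do not depend on it.\<close>

definition Delta0 :: "(bool \<Rightarrow> bool \<Rightarrow> bool \<Rightarrow> real) \<Rightarrow> real" where
  "Delta0 uR = uR False False False - uR False False True"

definition Delta1 :: "(bool \<Rightarrow> bool \<Rightarrow> bool \<Rightarrow> real) \<Rightarrow> real" where
  "Delta1 uR = uR True False True - uR True False False"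

definition sender_payoff ::
  "real \<Rightarrow> real \<Rightarrow> (bool \<Rightarrow> bool \<Rightarrow> bool \<Rightarrow> real) \<Rightarrow> (bool \<Rightarrow> bool \<Rightarrow> bool \<Rightarrow> real)
     \<Rightarrow> bool \<Rightarrow> (bool \<Rightarrow> real) \<Rightarrow> real" where
  "sender_payoff \<alpha> \<beta> uS \<sigma>R \<theta> d =
     (\<Sum>a\<in>UNIV. \<Sum>e\<in>UNIV. \<Sum>m\<in>UNIV. \<sigma>R m e a * detector \<alpha> \<beta> \<theta> m e * d m * uS \<theta> m a)"

definition receiver_payoff ::
  "(bool \<Rightarrow> bool \<Rightarrow> bool \<Rightarrow> real) \<Rightarrow> (bool \<Rightarrow> bool \<Rightarrow> bool \<Rightarrow> real)
     \<Rightarrow> bool \<Rightarrow> bool \<Rightarrow> (bool \<Rightarrow> real) \<Rightarrow> real" where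
  "receiver_payoff uR \<mu> m e d = (\<Sum>\<theta>\<in>UNIV. \<mu> m e \<theta> * (\<Sum>a\<in>UNIV. d a * uR \<theta> m a))"

definition reach_prob ::
  "real \<Rightarrow> real \<Rightarrow> real \<Rightarrow> (bool \<Rightarrow> bool \<Rightarrow> real) \<Rightarrow> bool \<Rightarrow> bool \<Rightarrow> real" where
  "reach_prob \<alpha> \<beta> p \<sigma>S m e = (\<Sum>\<theta>\<in>UNIV. detector \<alpha> \<beta> \<theta> m e * \<sigma>S \<theta> m * prior p \<theta>)"

definition PBNE ::
  "real \<Rightarrow> real \<Rightarrow> (bool \<Rightarrow> bool \<Rightarrow> bool \<Rightarrow> real) \<Rightarrow> (bool \<Rightarrow> bool \<Rightarrow> bool \<Rightarrow> real) \<Rightarrow> real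
     \<Rightarrow> (bool \<Rightarrow> bool \<Rightarrow> real) \<Rightarrow> (bool \<Rightarrow> bool \<Rightarrow> bool \<Rightarrow> real)
     \<Rightarrow> (bool \<Rightarrow> bool \<Rightarrow> bool \<Rightarrow> real) \<Rightarrow> bool" where
  "PBNE \<alpha> \<beta> uS uR p \<sigma>S \<sigma>R \<mu> \<longleftrightarrow>
     (\<forall>\<theta>. is_dist (\<sigma>S \<theta>)) \<and> (\<forall>m e. is_dist (\<sigma>R m e)) \<and> (\<forall>m e. is_dist (\<mu> m e)) \<and>
     (\<forall>\<theta> d. is_dist d \<longrightarrow>
        sender_payoff \<alpha> \<beta> uS \<sigma>R \<theta> d \<le> sender_payoff \<alpha> \<beta> uS \<sigma>R \<theta> (\<sigma>S \<theta>)) \<and>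
     (\<forall>m e d. is_dist d \<longrightarrow>
        receiver_payoff uR \<mu> m e d \<le> receiver_payoff uR \<mu> m e (\<sigma>R m e)) \<and>
     (\<forall>m e. reach_prob \<alpha> \<beta> p \<sigma>S m e > 0 \<longrightarrow>
        (\<forall>\<theta>. \<mu> m e \<theta> =
           detector \<alpha> \<beta> \<theta> m e * \<sigma>S \<theta> m * prior p \<theta> / reach_prob \<alpha> \<beta> p \<sigma>S m e))"

definition sender_equilibrium ::
  "real \<Rightarrow> real \<Rightarrow> (bool \<Rightarrow> bool \<Rightarrow> bool \<Rightarrow> real) \<Rightarrow> (bool \<Rightarrow> bool \<Rightarrow> bool \<Rightarrow> real) \<Rightarrow> real
     \<Rightarrow> (bool \<Rightarrow> bool \<Rightarrow> real) \<Rightarrow> bool" where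
  "sender_equilibrium \<alpha> \<beta> uS uR p \<sigma>S \<longleftrightarrow> (\<exists>\<sigma>R \<mu>. PBNE \<alpha> \<beta> uS uR p \<sigma>S \<sigma>R \<mu>)"

definition pure :: "(bool \<Rightarrow> bool \<Rightarrow> real) \<Rightarrow> bool" where
  "pure \<sigma>S \<longleftrightarrow> (\<forall>\<theta> m. \<sigma>S \<theta> m \<in> {0, 1})"

text \<open>
  What it means to be the sender's equilibrium strategy. A mixed strategy must be
  the only equilibrium strategy of the sender, whereas a pure one must be the only equilibrium
  strategy among the pure ones (this covers a pure strategy that is the only one
  altogether). The restriction to pure competitors cannot be dropped: in the Heavy
  regimes the receiver answers the pooling equilibrium with a constant action, one type of the
  sender is then indifferent, and there is a continuum of further, partially mixed equilibria
  around it. At most one strategy satisfies this predicate. For \<open>G = 0\<close> none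
  does: in the Middle regime both pooling strategies are then equilibria.
\<close>

definition unique_sender_equilibrium ::
  "real \<Rightarrow> real \<Rightarrow> (bool \<Rightarrow> bool \<Rightarrow> bool \<Rightarrow> real) \<Rightarrow> (bool \<Rightarrow> bool \<Rightarrow> bool \<Rightarrow> real) \<Rightarrow> real
     \<Rightarrow> (bool \<Rightarrow> bool \<Rightarrow> real) \<Rightarrow> bool" where
  "unique_sender_equilibrium \<alpha> \<beta> uS uR p \<sigma>S \<longleftrightarrow>
     sender_equilibrium \<alpha> \<beta> uS uR p \<sigma>S \<and>
     (\<forall>\<sigma>S'. sender_equilibrium \<alpha> \<beta> uS uR p \<sigma>S' \<and> (pure \<sigma>S \<longrightarrow> pure \<sigma>S') \<longrightarrow> \<sigma>S' = \<sigma>S)"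

definition alpha_of :: "real \<Rightarrow> real \<Rightarrow> real" where
  "alpha_of J G = (1 + G - J) / 2"

definition beta_of :: "real \<Rightarrow> real \<Rightarrow> real" where
  "beta_of J G = (1 + G + J) / 2"

definition truth_induction_rate ::
  "(bool \<Rightarrow> bool \<Rightarrow> bool \<Rightarrow> real) \<Rightarrow> (bool \<Rightarrow> bool \<Rightarrow> bool \<Rightarrow> real)
     \<Rightarrow> real \<Rightarrow> real \<Rightarrow> real \<Rightarrow> real" where
  "truth_induction_rate uS uR J G p =
     (let \<sigma>S = (THE \<sigma>. unique_sender_equilibrium (alpha_of J G) (beta_of J G) uS uR p \<sigma>)
      in \<Sum>\<theta>\<in>UNIV. prior p \<theta> * \<sigma>S \<theta> \<theta>)"

definition T1 :: "real \<Rightarrow> real \<Rightarrow> real \<Rightarrow> real \<Rightarrow> real" where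
  "T1 \<alpha> \<beta> D0 D1 = \<alpha> * D0 / (\<alpha> * D0 + \<beta> * D1)"

definition T2 :: "real \<Rightarrow> real \<Rightarrow> real \<Rightarrow> real \<Rightarrow> real" where
  "T2 \<alpha> \<beta> D0 D1 = (1 - \<beta>) * D0 / ((1 - \<beta>) * D0 + (1 - \<alpha>) * D1)"

definition T3 :: "real \<Rightarrow> real \<Rightarrow> real \<Rightarrow> real \<Rightarrow> real" where
  "T3 \<alpha> \<beta> D0 D1 = (1 - \<alpha>) * D0 / ((1 - \<alpha>) * D0 + (1 - \<beta>) * D1)"

definition T4 :: "real \<Rightarrow> real \<Rightarrow> real \<Rightarrow> real \<Rightarrow> real" where
  "T4 \<alpha> \<beta> D0 D1 = \<beta> * D0 / (\<beta> * D0 + \<alpha> * D1)"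

definition zero_heavy :: "real \<Rightarrow> real \<Rightarrow> real \<Rightarrow> real \<Rightarrow> real \<Rightarrow> bool" where
  "zero_heavy D0 D1 J G p \<longleftrightarrow>
     (let \<alpha> = alpha_of J G; \<beta> = beta_of J G in
        (G \<le> 0 \<and> T1 \<alpha> \<beta> D0 D1 < p \<and> p < T2 \<alpha> \<beta> D0 D1) \<or>
        (G \<ge> 0 \<and> T2 \<alpha> \<beta> D0 D1 < p \<and> p < T1 \<alpha> \<beta> D0 D1))"

definition middle :: "real \<Rightarrow> real \<Rightarrow> real \<Rightarrow> real \<Rightarrow> real \<Rightarrow> bool" where
  "middle D0 D1 J G p \<longleftrightarrow>
     (let \<alpha> = alpha_of J G; \<beta> = beta_of J G in
        (G \<le> 0 \<and> T2 \<alpha> \<beta> D0 D1 < p \<and> p < T3 \<alpha> \<beta> D0 D1) \<or>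
        (G \<ge> 0 \<and> T1 \<alpha> \<beta> D0 D1 < p \<and> p < T4 \<alpha> \<beta> D0 D1))"

definition one_heavy :: "real \<Rightarrow> real \<Rightarrow> real \<Rightarrow> real \<Rightarrow> real \<Rightarrow> bool" where
  "one_heavy D0 D1 J G p \<longleftrightarrow>
     (let \<alpha> = alpha_of J G; \<beta> = beta_of J G in
        (G \<le> 0 \<and> T3 \<alpha> \<beta> D0 D1 < p \<and> p < T4 \<alpha> \<beta> D0 D1) \<or>
        (G \<ge> 0 \<and> T4 \<alpha> \<beta> D0 D1 < p \<and> p < T3 \<alpha> \<beta> D0 D1))"

end

theory Submission
  imports Defs
begin

text \<open>
  With equal stakes the receiver follows the likelier type, so a PBNE reduces to linear
  inequalities between the probabilities \<open>q m e\<close> of action 1 and the sender's mixing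
  probabilities. Exchanging \<open>(m, e)\<close> with \<open>(\<not> m, \<not> e)\<close> turns the detector \<open>(J, G)\<close> into
  \<open>(J, -G)\<close> and \<open>\<tau>\<close> into \<open>1 - \<tau>\<close>, so it suffices to treat \<open>G < 0\<close>. There the
  Zero-Heavy regime has pooling on message 1, whence \<open>\<tau> = p < 1/2\<close>, and the One-Heavy regime
  is its mirror image under negating types, messages and actions. In the Middle regime the
  receiver trusts the alarm and mixes without it; her indifference determines the
  sender's strategy and gives \<open>\<tau> = T\<^sub>2 < 1/2\<close>, independently of \<open>p\<close>. For \<open>G = 0\<close> both
  pooling strategies are equilibria, so no unique one exists.
\<close>

section \<open>Distributions on two points and best responses\<close>

lemma is_dist_iff: "is_dist d \<longleftrightarrow> 0 \<le> d True \<and> d True \<le> 1 \<and> d False = 1 - d True"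
  by (auto simp: is_dist_def UNIV_bool all_bool_eq)

lemma is_dist_prior: "is_dist (prior x) \<longleftrightarrow> 0 \<le> x \<and> x \<le> 1"
  by (auto simp: is_dist_iff prior_def)

lemma is_dist_eq_prior: "is_dist d \<Longrightarrow> d = prior (d True)"
  by (auto simp: is_dist_iff prior_def fun_eq_iff)

text \<open>The payoff is linear in \<open>d\<close>, so the two pure strategies are the only
  deviations to test.\<close>

lemma best_response_iff:
  assumes "is_dist s"
  shows "(\<forall>d. is_dist d \<longrightarrow> (\<Sum>x\<in>UNIV. d x * f x) \<le> (\<Sum>x\<in>UNIV. s x * f x)) \<longleftrightarrow>
         (\<forall>x. 0 < s x \<longrightarrow> f (\<not> x) \<le> f x)" (is "?L \<longleftrightarrow> ?R")
proof
  assume L: ?L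
  have s: "s False = 1 - s True" "0 \<le> s True" "s True \<le> 1"
    using assms by (auto simp: is_dist_iff)
  have 1: "f True \<le> s True * f True + (1 - s True) * f False"
    using L[rule_format, of "prior 1"] s by (simp add: is_dist_prior UNIV_bool prior_def)
  have 0: "f False \<le> s True * f True + (1 - s True) * f False"
    using L[rule_format, of "prior 0"] s by (simp add: is_dist_prior UNIV_bool prior_def)
  have "(1 - s True) * (f True - f False) \<le> 0" "s True * (f False - f True) \<le> 0"
    using 0 1 by (simp_all add: algebra_simps)
  then show ?R
    using s by (auto simp: all_bool_eq mult_le_0_iff)
next
  assume R: ?R
  show ?L
  proof (intro allI impI)
    fix d :: "bool \<Rightarrow> real" assume d: "is_dist d"
    \<comment> \<open>The payoff difference factors into this product. If \<open>s\<close> mixes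
      properly, both alternatives lie in its support and the second factor is 0.\<close>
    have "(d True - s True) * (f True - f False) \<le> 0"
    proof (cases "s True = 0 \<or> s True = 1")
      case True
      then show ?thesis
        using R d assms by (auto simp: is_dist_iff all_bool_eq mult_le_0_iff)
    next
      case False
      then have "f True = f False"
        using R assms by (auto simp: is_dist_iff all_bool_eq)
      then show ?thesis by simp
    qed
    moreover have "d False = 1 - d True" "s False = 1 - s True"
      using d assms by (simp_all add: is_dist_iff)
    ultimately show "(\<Sum>x\<in>UNIV. d x * f x) \<le> (\<Sum>x\<in>UNIV. s x * f x)"
      by (simp add: UNIV_bool left_diff_distrib right_diff_distrib)
  qed
qed

section \<open>Reduction of a PBNE to inequalities\<close>

definition high_action_prob ::
  "real \<Rightarrow> real \<Rightarrow> (bool \<Rightarrow> bool \<Rightarrow> real) \<Rightarrow> bool \<Rightarrow> bool \<Rightarrow> real" where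
  "high_action_prob \<alpha> \<beta> q \<theta> m = (\<Sum>e\<in>UNIV. detector \<alpha> \<beta> \<theta> m e * q m e)"

text \<open>This is the numerator in Bayes' law; comparing unnormalised weights avoids dividing by
  \<open>reach_prob\<close>.\<close>

definition joint_prob ::
  "real \<Rightarrow> real \<Rightarrow> real \<Rightarrow> (bool \<Rightarrow> bool \<Rightarrow> real) \<Rightarrow> bool \<Rightarrow> bool \<Rightarrow> bool \<Rightarrow> real" where
  "joint_prob \<alpha> \<beta> p \<sigma> m e \<theta> = detector \<alpha> \<beta> \<theta> m e * \<sigma> \<theta> m * prior p \<theta>"

text \<open>Type 0 wants action 1 to be as likely as possible, type 1 as unlikely as possible. Off
  the path both joint probabilities are 0, so the last two clauses leave \<open>q m e\<close> free;
  this replaces the arbitrary beliefs.\<close>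

definition reduced_equilibrium ::
  "real \<Rightarrow> real \<Rightarrow> real \<Rightarrow> (bool \<Rightarrow> bool \<Rightarrow> real) \<Rightarrow> (bool \<Rightarrow> bool \<Rightarrow> real) \<Rightarrow> bool" where
  "reduced_equilibrium \<alpha> \<beta> p \<sigma> q \<longleftrightarrow>
     (\<forall>\<theta>. is_dist (\<sigma> \<theta>)) \<and> (\<forall>m e. 0 \<le> q m e \<and> q m e \<le> 1) \<and>
     (\<forall>m. 0 < \<sigma> False m \<longrightarrow>
        high_action_prob \<alpha> \<beta> q False (\<not> m) \<le> high_action_prob \<alpha> \<beta> q False m) \<and>
     (\<forall>m. 0 < \<sigma> True m \<longrightarrow>
        high_action_prob \<alpha> \<beta> q True m \<le> high_action_prob \<alpha> \<beta> q True (\<not> m)) \<and>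
     (\<forall>m e. joint_prob \<alpha> \<beta> p \<sigma> m e False < joint_prob \<alpha> \<beta> p \<sigma> m e True \<longrightarrow> q m e = 1) \<and>
     (\<forall>m e. joint_prob \<alpha> \<beta> p \<sigma> m e True < joint_prob \<alpha> \<beta> p \<sigma> m e False \<longrightarrow> q m e = 0)"

text \<open>The payoff of a message is affine in the probability of action 1 that it induces, with a
  slope \<open>k\<close> that is positive for type 0 and negative for type 1.\<close>

lemma sender_optimal_iff:
  assumes "deception_utilities uS uR" and R: "\<And>m e. is_dist (\<sigma>R m e)" and "is_dist s"
  shows "(\<forall>d. is_dist d \<longrightarrow>
            sender_payoff \<alpha> \<beta> uS \<sigma>R \<theta> d \<le> sender_payoff \<alpha> \<beta> uS \<sigma>R \<theta> s) \<longleftrightarrow>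
         (\<forall>m. 0 < s m \<longrightarrow>
            (let h = high_action_prob \<alpha> \<beta> (\<lambda>m e. \<sigma>R m e True) \<theta>
             in if \<theta> then h m \<le> h (\<not> m) else h (\<not> m) \<le> h m))"
proof -
  define h where "h = high_action_prob \<alpha> \<beta> (\<lambda>m e. \<sigma>R m e True) \<theta>"
  define k where "k = uS \<theta> False True - uS \<theta> False False"
  define f where "f m = uS \<theta> False False + k * h m" for m
  have u: "uS \<theta> m a = uS \<theta> False a" for m a
    using assms(1) unfolding deception_utilities_def by blast
  have R0: "\<sigma>R m e False = 1 - \<sigma>R m e True" for m e
    using R[of m e] by (simp add: is_dist_iff)
  have "sender_payoff \<alpha> \<beta> uS \<sigma>R \<theta> d = (\<Sum>m\<in>UNIV. d m * f m)" for d
    unfolding sender_payoff_def f_def h_def k_def high_action_prob_def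
    by (simp add: UNIV_bool u[of True] R0 detector_def Let_def algebra_simps)
  then have "(\<forall>d. is_dist d \<longrightarrow>
      sender_payoff \<alpha> \<beta> uS \<sigma>R \<theta> d \<le> sender_payoff \<alpha> \<beta> uS \<sigma>R \<theta> s) \<longleftrightarrow>
      (\<forall>m. 0 < s m \<longrightarrow> f (\<not> m) \<le> f m)"
    using best_response_iff[OF assms(3), of f] by simp
  moreover have "f (\<not> m) \<le> f m \<longleftrightarrow> (if \<theta> then h m \<le> h (\<not> m) else h (\<not> m) \<le> h m)" for m
  proof (cases \<theta>)
    case True
    then have "k < 0" using assms(1) by (simp add: k_def deception_utilities_def)
    then show ?thesis using True by (simp add: f_def)
  next
    case False
    then have "k > 0" using assms(1) by (simp add: k_def deception_utilities_def)
    then show ?thesis using False by (simp add: f_def)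
  qed
  ultimately show ?thesis by (simp add: h_def Let_def)
qed

text \<open>Equal stakes make the gain of action 1 over action 0 a positive multiple of
  \<open>\<mu> m e True - \<mu> m e False\<close>; at a tie every mixture is optimal.\<close>

lemma receiver_optimal_iff:
  assumes "deception_utilities uS uR" and "Delta0 uR = Delta1 uR" and "is_dist s"
  shows "(\<forall>d. is_dist d \<longrightarrow> receiver_payoff uR \<mu> m e d \<le> receiver_payoff uR \<mu> m e s) \<longleftrightarrow>
         (\<mu> m e False < \<mu> m e True \<longrightarrow> s True = 1) \<and> (\<mu> m e True < \<mu> m e False \<longrightarrow> s True = 0)"
proof -
  define f where "f a = (\<Sum>\<theta>\<in>UNIV. \<mu> m e \<theta> * uR \<theta> m a)" for a
  have u: "uR \<theta> m a = uR \<theta> False a" for \<theta> a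
    using assms(1) unfolding deception_utilities_def by blast
  have D: "Delta1 uR > 0"
    using assms(1) by (simp add: Delta1_def deception_utilities_def)
  have "f True - f False = \<mu> m e True * Delta1 uR - \<mu> m e False * Delta0 uR"
    by (simp add: f_def UNIV_bool u Delta0_def Delta1_def algebra_simps)
  also have "\<dots> = (\<mu> m e True - \<mu> m e False) * Delta1 uR"
    using assms(2) by (simp add: algebra_simps)
  finally have f: "f True - f False = (\<mu> m e True - \<mu> m e False) * Delta1 uR" .
  have "f False \<le> f True \<longleftrightarrow> 0 \<le> (\<mu> m e True - \<mu> m e False) * Delta1 uR"
    using f by linarith
  moreover have "f True \<le> f False \<longleftrightarrow> (\<mu> m e True - \<mu> m e False) * Delta1 uR \<le> 0"
    using f by linarith
  ultimately have ff: "f False \<le> f True \<longleftrightarrow> \<mu> m e False \<le> \<mu> m e True"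
    "f True \<le> f False \<longleftrightarrow> \<mu> m e True \<le> \<mu> m e False"
    using D by (auto simp: zero_le_mult_iff mult_le_0_iff)
  have "receiver_payoff uR \<mu> m e d = (\<Sum>a\<in>UNIV. d a * f a)" for d
    by (simp add: receiver_payoff_def f_def UNIV_bool algebra_simps)
  then have "(\<forall>d. is_dist d \<longrightarrow> receiver_payoff uR \<mu> m e d \<le> receiver_payoff uR \<mu> m e s) \<longleftrightarrow>
      (\<forall>a. 0 < s a \<longrightarrow> f (\<not> a) \<le> f a)"
    using best_response_iff[OF assms(3), of f] by simp
  also have "\<dots> \<longleftrightarrow> (\<mu> m e False < \<mu> m e True \<longrightarrow> s True = 1) \<and>
      (\<mu> m e True < \<mu> m e False \<longrightarrow> s True = 0)"
    using assms(3) by (auto simp: all_bool_eq ff is_dist_iff)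
  finally show ?thesis .
qed

lemma detector_nonneg: "0 \<le> \<alpha> \<Longrightarrow> \<alpha> \<le> \<beta> \<Longrightarrow> \<beta> \<le> 1 \<Longrightarrow> 0 \<le> detector \<alpha> \<beta> \<theta> m e"
  by (simp add: detector_def Let_def)

lemma joint_prob_nonneg:
  assumes "0 \<le> \<alpha>" "\<alpha> \<le> \<beta>" "\<beta> \<le> 1" "0 \<le> p" "p \<le> 1" "is_dist (\<sigma> \<theta>)"
  shows "0 \<le> joint_prob \<alpha> \<beta> p \<sigma> m e \<theta>"
  using assms detector_nonneg[of \<alpha> \<beta> \<theta> m e] unfolding joint_prob_def is_dist_def
  by (simp add: prior_def)

lemma reach_prob_joint:
  "reach_prob \<alpha> \<beta> p \<sigma> m e = joint_prob \<alpha> \<beta> p \<sigma> m e True + joint_prob \<alpha> \<beta> p \<sigma> m e False"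
  by (simp add: reach_prob_def joint_prob_def UNIV_bool)

text \<open>On the path the belief is \<open>joint_prob\<close> divided by a positive number, so
  both rank the types alike.\<close>

lemma sender_equilibrium_iff:
  assumes dec: "deception_utilities uS uR" and D: "Delta0 uR = Delta1 uR"
    and ab: "0 \<le> \<alpha>" "\<alpha> \<le> \<beta>" "\<beta> \<le> 1" and p: "0 \<le> p" "p \<le> 1"
  shows "sender_equilibrium \<alpha> \<beta> uS uR p \<sigma> \<longleftrightarrow> (\<exists>q. reduced_equilibrium \<alpha> \<beta> p \<sigma> q)"
proof
  assume "sender_equilibrium \<alpha> \<beta> uS uR p \<sigma>"
  then obtain \<sigma>R \<mu> where E: "PBNE \<alpha> \<beta> uS uR p \<sigma> \<sigma>R \<mu>"
    by (auto simp: sender_equilibrium_def)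
  then have d: "\<And>\<theta>. is_dist (\<sigma> \<theta>)" "\<And>m e. is_dist (\<sigma>R m e)"
    and S: "\<And>\<theta>. \<forall>d. is_dist d \<longrightarrow>
        sender_payoff \<alpha> \<beta> uS \<sigma>R \<theta> d \<le> sender_payoff \<alpha> \<beta> uS \<sigma>R \<theta> (\<sigma> \<theta>)"
    and R: "\<And>m e. \<forall>d. is_dist d \<longrightarrow>
        receiver_payoff uR \<mu> m e d \<le> receiver_payoff uR \<mu> m e (\<sigma>R m e)"
    and B: "\<And>m e \<theta>. reach_prob \<alpha> \<beta> p \<sigma> m e > 0 \<Longrightarrow>
        \<mu> m e \<theta> = joint_prob \<alpha> \<beta> p \<sigma> m e \<theta> / reach_prob \<alpha> \<beta> p \<sigma> m e"
    unfolding PBNE_def joint_prob_def by blast+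
  note jn = joint_prob_nonneg[where p = p and \<sigma> = \<sigma>, OF ab p d(1)]
  have R': "(\<mu> m e False < \<mu> m e True \<longrightarrow> \<sigma>R m e True = 1) \<and>
      (\<mu> m e True < \<mu> m e False \<longrightarrow> \<sigma>R m e True = 0)" for m e
    using R[of m e] receiver_optimal_iff[OF dec D d(2), of \<mu> m e m e] by simp
  have q: "(joint_prob \<alpha> \<beta> p \<sigma> m e False < joint_prob \<alpha> \<beta> p \<sigma> m e True \<longrightarrow> \<sigma>R m e True = 1) \<and>
      (joint_prob \<alpha> \<beta> p \<sigma> m e True < joint_prob \<alpha> \<beta> p \<sigma> m e False \<longrightarrow> \<sigma>R m e True = 0)" for m e
  proof (cases "reach_prob \<alpha> \<beta> p \<sigma> m e > 0")
    case True
    then show ?thesis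
      using R'[of m e] B[OF True] by (simp add: divide_less_cancel)
  next
    \<comment> \<open>Nonnegative weights whose sum is not positive both vanish, so neither
      implication has a true premise.\<close>
    case False
    then show ?thesis
      using jn[of m e True] jn[of m e False] by (simp add: reach_prob_joint)
  qed
  have "reduced_equilibrium \<alpha> \<beta> p \<sigma> (\<lambda>m e. \<sigma>R m e True)"
    unfolding reduced_equilibrium_def
    using d q S[of False] S[of True]
    unfolding sender_optimal_iff[OF dec d(2) d(1)] Let_def
    by (simp add: is_dist_iff)
  then show "\<exists>q. reduced_equilibrium \<alpha> \<beta> p \<sigma> q" by blast
next
  assume "\<exists>q. reduced_equilibrium \<alpha> \<beta> p \<sigma> q"
  then obtain q where E: "reduced_equilibrium \<alpha> \<beta> p \<sigma> q" by blast
  define \<sigma>R where "\<sigma>R m e = prior (q m e)" for m e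
  let ?r = "reach_prob \<alpha> \<beta> p \<sigma>"
  \<comment> \<open>Off the path the uniform belief makes every receiver strategy optimal, because
      the two stakes are equal.\<close>
  define \<mu> where "\<mu> m e \<theta> =
    (if ?r m e > 0 then joint_prob \<alpha> \<beta> p \<sigma> m e \<theta> / ?r m e else 1 / 2)" for m e \<theta>
  have d: "\<And>\<theta>. is_dist (\<sigma> \<theta>)" "\<And>m e. is_dist (\<sigma>R m e)"
    and q: "\<And>m e. \<sigma>R m e True = q m e"
    using E by (auto simp: reduced_equilibrium_def \<sigma>R_def is_dist_prior prior_def)
  note jn = joint_prob_nonneg[where p = p and \<sigma> = \<sigma>, OF ab p d(1)]
  have m: "is_dist (\<mu> m e)" for m e
  proof (cases "?r m e > 0")
    case True
    then have "\<mu> m e True + \<mu> m e False = 1"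
      by (simp add: \<mu>_def reach_prob_joint flip: add_divide_distrib)
    moreover have "0 \<le> \<mu> m e \<theta>" for \<theta>
      using True jn[of m e \<theta>] by (simp add: \<mu>_def)
    ultimately show ?thesis by (simp add: is_dist_def UNIV_bool add.commute)
  qed (simp add: is_dist_def UNIV_bool \<mu>_def)
  have R: "(\<mu> m e False < \<mu> m e True \<longrightarrow> \<sigma>R m e True = 1) \<and>
      (\<mu> m e True < \<mu> m e False \<longrightarrow> \<sigma>R m e True = 0)" for m e
    using E by (auto simp: q reduced_equilibrium_def \<mu>_def divide_less_cancel)
  have S: "\<forall>d. is_dist d \<longrightarrow>
      sender_payoff \<alpha> \<beta> uS \<sigma>R \<theta> d \<le> sender_payoff \<alpha> \<beta> uS \<sigma>R \<theta> (\<sigma> \<theta>)" for \<theta>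
    unfolding sender_optimal_iff[OF dec d(2) d(1)] Let_def q
    using E by (cases \<theta>) (auto simp: reduced_equilibrium_def)
  have "PBNE \<alpha> \<beta> uS uR p \<sigma> \<sigma>R \<mu>"
    unfolding PBNE_def
    using d m S R receiver_optimal_iff[OF dec D d(2)]
    by (auto simp: \<mu>_def joint_prob_def)
  then show "sender_equilibrium \<alpha> \<beta> uS uR p \<sigma>"
    by (auto simp: sender_equilibrium_def)
qed

section \<open>The Middle regime for G < 0: indifference of the receiver\<close>

text \<open>Suppose both types pool on message 0 and the receiver plays action 1 exactly after an
  alarm. With \<open>x\<close> and \<open>y\<close> her probabilities of action 1 after message 1,
  without and with an alarm, the two inequalities say that neither type deviates. Eliminating
  \<open>x\<close> leaves a product of two positive factors that is at most 0.\<close>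

lemma no_informative_pooling:
  fixes \<alpha> \<beta> x y :: real
  assumes "\<alpha> < \<beta>" "\<alpha> + \<beta> < 1" "\<beta> < 1" "0 \<le> y"
    and *: "(1 - \<beta>) * x + \<beta> * y \<le> \<alpha>" "\<beta> \<le> (1 - \<alpha>) * x + \<alpha> * y"
  shows False
proof -
  have "(1 - \<alpha>) * ((1 - \<beta>) * x + \<beta> * y) \<le> (1 - \<alpha>) * \<alpha>"
    "(1 - \<beta>) * \<beta> \<le> (1 - \<beta>) * ((1 - \<alpha>) * x + \<alpha> * y)"
    using assms by (intro mult_left_mono; simp)+
  then have "(\<beta> - \<alpha>) * (1 - \<alpha> - \<beta> + y) \<le> 0"
    by (simp add: algebra_simps)
  moreover have "(\<beta> - \<alpha>) * (1 - \<alpha> - \<beta> + y) > 0"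
    using assms by (intro mult_pos_pos) auto
  ultimately show False by simp
qed

text \<open>
  Here \<open>u\<close> and \<open>v\<close> are the joint probabilities of message 1 with type 1 and type 0, and
  \<open>x\<^sub>m\<close>, \<open>y\<^sub>m\<close> are the probabilities of action 1 after message \<open>m\<close> without and with an alarm.
  The conclusion says that the receiver is indifferent whenever there is no alarm.
\<close>

lemma middle_regime_balance:
  fixes \<alpha> \<beta> p u v x0 y0 x1 y1 :: real
  defines "a \<equiv> 1 - \<alpha>" and "b \<equiv> 1 - \<beta>"
  assumes \<alpha>: "0 \<le> \<alpha>" and \<alpha>\<beta>: "\<alpha> < \<beta>" "\<alpha> + \<beta> < 1"
    and p: "b * (1 - p) < a * p" "b * p < a * (1 - p)"
    and u: "0 \<le> u" "u \<le> p" and v: "0 \<le> v" "v \<le> 1 - p"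
    and q: "0 \<le> x0" "x0 \<le> 1" "0 \<le> y0" "y0 \<le> 1" "0 \<le> x1" "x1 \<le> 1" "0 \<le> y1" "y1 \<le> 1"
    and S0: "v < 1 - p \<Longrightarrow> b * x1 + \<beta> * y1 \<le> a * x0 + \<alpha> * y0"
      "0 < v \<Longrightarrow> a * x0 + \<alpha> * y0 \<le> b * x1 + \<beta> * y1"
    and S1: "u < p \<Longrightarrow> b * x0 + \<beta> * y0 \<le> a * x1 + \<alpha> * y1"
      "0 < u \<Longrightarrow> a * x1 + \<alpha> * y1 \<le> b * x0 + \<beta> * y0"
    and X0: "a * (1 - p - v) < b * (p - u) \<Longrightarrow> x0 = 1" "b * (p - u) < a * (1 - p - v) \<Longrightarrow> x0 = 0"
    and Y0: "\<alpha> * (1 - p - v) < \<beta> * (p - u) \<Longrightarrow> y0 = 1" "\<beta> * (p - u) < \<alpha> * (1 - p - v) \<Longrightarrow> y0 = 0"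
    and X1: "b * v < a * u \<Longrightarrow> x1 = 1" "a * u < b * v \<Longrightarrow> x1 = 0"
    and Y1: "\<beta> * v < \<alpha> * u \<Longrightarrow> y1 = 1" "\<alpha> * u < \<beta> * v \<Longrightarrow> y1 = 0"
  shows "a * u = b * v \<and> b * (p - u) = a * (1 - p - v)"
proof -
  have pos: "0 < b" "b < a" "0 < \<beta>" "\<beta> < 1" "0 < a" "a \<le> 1"
    using \<alpha> \<alpha>\<beta> by (auto simp: a_def b_def)
  have p01: "0 < p" "p < 1"
    using p u v pos by (smt (verit) mult_nonneg_nonneg mult_eq_0_iff)+
  \<comment> \<open>The product equals \<open>\<beta> * b - \<alpha> * a\<close>.\<close>
  have "0 < (\<beta> - \<alpha>) * (1 - \<alpha> - \<beta>)" using \<alpha>\<beta> by simp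
  then have ratio: "\<alpha> * a < \<beta> * b" by (simp add: a_def b_def algebra_simps)
  \<comment> \<open>By \<open>ratio\<close> the thresholds are nested: a prior between T2 and T3
    also lies between T1 and T4.\<close>
  have T1: "\<alpha> * (1 - p) < \<beta> * p"
  proof -
    have "b * (\<alpha> * (1 - p)) \<le> \<alpha> * a * p"
      using mult_left_mono[OF less_imp_le[OF p(1)] \<alpha>] by (simp add: algebra_simps)
    also have "\<dots> < \<beta> * b * p" using ratio p01 by simp
    finally show ?thesis using pos by (simp add: mult.commute mult.left_commute)
  qed
  have T4: "\<alpha> * p < \<beta> * (1 - p)"
  proof -
    have "b * (\<alpha> * p) \<le> \<alpha> * a * (1 - p)"
      using mult_left_mono[OF less_imp_le[OF p(2)] \<alpha>] by (simp add: algebra_simps)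
    also have "\<dots> < \<beta> * b * (1 - p)" using ratio p01 by simp
    finally show ?thesis using pos by (simp add: mult.commute mult.left_commute)
  qed
  \<comment> \<open>At every boundary value of \<open>u\<close> or \<open>v\<close> some type gains
    by deviating; only the case in which both types mix survives.\<close>
  consider "v = 0" | "0 < v" "v < 1 - p" | "v = 1 - p" using v by linarith
  then show ?thesis
  proof cases
    case 1
    have "b * (p - u) \<le> b * p" using u pos by simp
    then have x0: "x0 = 0" using X0 p 1 by simp
    show ?thesis
    proof (cases "u = 0")
      case True
      then have "y0 = 1" using Y0 T1 1 by simp
      then show ?thesis
        using S0 S1 1 True p01 x0 no_informative_pooling[OF \<alpha>\<beta> pos(4) q(7), of x1]
        by (simp add: a_def b_def)
    next
      case False
      then have "x1 = 1" using X1 u pos 1 by simp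
      \<comment> \<open>Here only type 1 sends message 1. If \<alpha> = 0, an alarm then never
        occurs and \<open>y1\<close> is unrestricted, but \<open>b > 0\<close> alone contradicts the
        optimality of type 0.\<close>
      moreover have "y1 = 1" if "\<alpha> \<noteq> 0" using Y1 \<alpha> that False u 1 by simp
      moreover have "\<alpha> * y0 \<le> \<alpha>" using \<alpha> q by (simp add: mult_left_le)
      moreover have "0 \<le> \<beta> * y1" using q pos by simp
      ultimately show ?thesis
        using S0(1) x0 1 p01 pos \<alpha>\<beta> by (cases "\<alpha> = 0") (auto simp: a_def b_def)
    qed
  next
    case 2
    then have I0: "a * x0 + \<alpha> * y0 = b * x1 + \<beta> * y1" using S0 by simp
    consider "u = 0" | "0 < u" "u < p" | "u = p" using u by linarith
    then show ?thesis
    proof cases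
      case 1
      then have x1: "x1 = 0" "y1 = 0" using X1 Y1 2 pos by simp_all
      have "\<alpha> * (1 - p - v) \<le> \<alpha> * (1 - p)" using \<alpha> v by (simp add: mult_left_mono)
      then have "y0 = 1" using Y0(1) T1 1 by simp
      moreover have "0 \<le> b * x0" using pos q by simp
      moreover have "b * x0 + \<beta> * y0 \<le> 0" using S1(1) 1 p01 x1 by simp
      ultimately have False using pos by simp
      then show ?thesis ..
    next
      case 3
      then have x0: "x0 = 0" using X0 2 pos by simp
      have y0: "\<alpha> * y0 = 0" using Y0(2) 2 3 \<alpha> by (cases "\<alpha> = 0") auto
      have "b * v < b * (1 - p)" using 2 pos by simp
      then have "x1 = 1" using X1 p 3 by simp
      moreover have "0 \<le> \<beta> * y1" using pos q by simp
      ultimately have False using I0 x0 y0 pos by simp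
      then show ?thesis ..
    next
      case u: 2
      then have I1: "a * x1 + \<alpha> * y1 = b * x0 + \<beta> * y0" using S1 by simp
      define g where "g = 1 - \<alpha> - \<beta>"
      have g: "0 < g" "g < 1" using \<alpha> \<alpha>\<beta> by (auto simp: g_def)
      \<comment> \<open>Cramer's rule for \<open>I0\<close> and \<open>I1\<close> as equations in
        \<open>x0\<close>, \<open>y0\<close>; the determinant
        \<open>a * \<beta> - \<alpha> * b\<close> is \<beta> - \<alpha>.\<close>
      have "(\<beta> - \<alpha>) * x0 = (\<beta> - \<alpha>) * (g * x1 + (1 - g) * y1)"
        "(\<beta> - \<alpha>) * y0 = (\<beta> - \<alpha>) * (x1 + g * (x1 - y1))"
        using arg_cong[OF I0, of "(*) \<beta>"] arg_cong[OF I1, of "(*) \<alpha>"]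
          arg_cong[OF I0, of "(*) b"] arg_cong[OF I1, of "(*) a"]
        by (simp_all add: a_def b_def g_def algebra_simps)
      then have x0: "x0 = g * x1 + (1 - g) * y1" and y0: "y0 = x1 + g * (x1 - y1)"
        using \<alpha>\<beta> by simp_all
      have pp: "b * (u + (p - u)) < a * (v + (1 - p - v))"
        "b * (v + (1 - p - v)) < a * (u + (p - u))" using p by simp_all
      \<comment> \<open>An alarm shifts the odds by \<open>\<beta> / \<alpha>\<close>, its absence only by \<open>a / b\<close>, which is smaller.\<close>
      have mono: "b * w < a * w'" if "\<beta> * w \<le> \<alpha> * w'" "0 < w'" for w w'
      proof -
        have "\<beta> * (b * w) \<le> \<alpha> * b * w'"
          using mult_left_mono[OF that(1), of b] pos by (simp add: algebra_simps)
        also have "\<dots> \<le> \<alpha> * a * w'" using pos \<alpha> that by (simp add: mult_mono)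
        also have "\<dots> < \<beta> * b * w'" using ratio that by simp
        also have "\<dots> < \<beta> * a * w'" using pos that by simp
        finally show ?thesis using pos by (simp add: mult.assoc)
      qed
      have cross: "a * w < b * w'" if "\<alpha> * w' \<ge> \<beta> * w" "0 < w'" for w w'
      proof -
        have "\<beta> * (a * w) \<le> \<alpha> * a * w'"
          using mult_left_mono[OF that(1), of a] pos by (simp add: algebra_simps)
        also have "\<dots> < \<beta> * b * w'" using ratio that by simp
        finally show ?thesis using pos by (simp add: mult.assoc)
      qed
      \<comment> \<open>Otherwise the receiver would play action 1 everywhere, and adding the
        inequalities for the two messages without an alarm would give
        \<open>a * (1 - p) < b * p\<close>.\<close>
      have y1: "y1 = 0"
      proof (rule ccontr)
        assume "y1 \<noteq> 0"
        then have 1: "\<beta> * v \<le> \<alpha> * u" using Y1 by force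
        then have "b * v < a * u" using mono u by simp
        then have "x1 = 1" using X1 by simp
        then have "y1 = 1" using y0 q g by (smt (verit) mult_pos_pos)
        then have "x0 = 1" using x0 \<open>x1 = 1\<close> by simp
        then have "a * (1 - p - v) \<le> b * (p - u)" using X0 by force
        moreover have "a * v < b * u" using cross[OF 1] u by simp
        ultimately show False using pp(1) by (simp add: algebra_simps)
      qed
      \<comment> \<open>Otherwise the receiver would play action 0 everywhere, and the same addition
        would give \<open>a * p < b * (1 - p)\<close>.\<close>
      have "x1 \<noteq> 0"
      proof
        assume "x1 = 0"
        then have "a * u \<le> b * v" using X1 by force
        have "y0 = 0" using y0 y1 \<open>x1 = 0\<close> by simp
        then have "\<beta> * (p - u) \<le> \<alpha> * (1 - p - v)" using Y0 by force
        then have "a * (p - u) < b * (1 - p - v)" using cross 2 by simp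
        then show False using pp(2) \<open>a * u \<le> b * v\<close> by (simp add: algebra_simps)
      qed
      then have "0 < x0" using x0 y1 g q by simp
      then have "a * (1 - p - v) \<le> b * (p - u)" using X0 by force
      have "y0 = 1"
      proof -
        have "\<alpha> * (1 - p - v) < \<beta> * (p - u)"
        proof (rule ccontr)
          assume "\<not> ?thesis"
          then have "b * (p - u) < a * (1 - p - v)" using mono 2 by simp
          then show False using \<open>a * (1 - p - v) \<le> b * (p - u)\<close> by simp
        qed
        then show ?thesis using Y0 by simp
      qed
      \<comment> \<open>So \<open>x1 = 1 / (1 + g)\<close> and \<open>x0 = g / (1 + g)\<close>. Both
        are properly mixed, which excludes every strict preference without an alarm.\<close>
      then have "(1 + g) * x1 = 1" using y0 y1 by (simp add: algebra_simps)
      then have "x1 + g * x1 = 1" by (simp add: algebra_simps)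
      moreover have "0 < x1" "0 < g * x1" using \<open>x1 \<noteq> 0\<close> q g by simp_all
      ultimately have "x1 < 1" "x0 < 1" using x0 y1 by simp_all
      then have "\<not> b * v < a * u" "\<not> a * u < b * v"
        "\<not> a * (1 - p - v) < b * (p - u)" "\<not> b * (p - u) < a * (1 - p - v)"
        using X0 X1 \<open>0 < x0\<close> \<open>0 < x1\<close> by fastforce+
      then show ?thesis by linarith
    qed
  next
    case 3
    show ?thesis
    proof (cases "u = p")
      case True
      have "x1 = 1" "y1 = 0" using X1 Y1 T4 True 3 p by simp_all
      moreover have "0 \<le> 1 - y0" using q by simp
      \<comment> \<open>Pooling on message 1 is the earlier pooling with the actions exchanged,
        hence the complements \<open>1 - x0\<close> and \<open>1 - y0\<close>.\<close>
      ultimately show ?thesis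
        using S0 S1 3 True p01 no_informative_pooling[OF \<alpha>\<beta> pos(4), of "1 - y0" "1 - x0"]
        by (simp add: a_def b_def algebra_simps)
    next
      case False
      then have q0: "x0 = 1" "y0 = 1" using X0 Y0 3 u pos by simp_all
      have "\<alpha> * u \<le> \<alpha> * p" using \<alpha> u by (simp add: mult_left_mono)
      then have "y1 = 0" using Y1 T4 3 by simp
      moreover have "b * x1 \<le> b" using pos q by (simp add: mult_left_le)
      moreover have "a + \<alpha> = 1" "b < 1" using pos by (simp_all add: a_def b_def)
      ultimately have False using S0(2) 3 p01 q0 by simp
      then show ?thesis ..
    qed
  qed
qed

section \<open>Uniqueness and the two symmetries\<close>

definition unique_reduced_equilibrium ::
  "real \<Rightarrow> real \<Rightarrow> real \<Rightarrow> (bool \<Rightarrow> bool \<Rightarrow> real) \<Rightarrow> bool" where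
  "unique_reduced_equilibrium \<alpha> \<beta> p \<sigma> \<longleftrightarrow>
     (\<exists>q. reduced_equilibrium \<alpha> \<beta> p \<sigma> q) \<and>
     (\<forall>\<sigma>' q. reduced_equilibrium \<alpha> \<beta> p \<sigma>' q \<and> (pure \<sigma> \<longrightarrow> pure \<sigma>') \<longrightarrow> \<sigma>' = \<sigma>)"

lemma unique_sender_equilibrium_iff:
  assumes "deception_utilities uS uR" and "Delta0 uR = Delta1 uR"
    and "0 \<le> \<alpha>" "\<alpha> \<le> \<beta>" "\<beta> \<le> 1" and "0 \<le> p" "p \<le> 1"
  shows "unique_sender_equilibrium \<alpha> \<beta> uS uR p \<sigma> \<longleftrightarrow> unique_reduced_equilibrium \<alpha> \<beta> p \<sigma>"
  unfolding unique_sender_equilibrium_def unique_reduced_equilibrium_def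
    sender_equilibrium_iff[OF assms] by blast

lemma unique_reduced_equilibrium_unique:
  "unique_reduced_equilibrium \<alpha> \<beta> p \<sigma> \<Longrightarrow> unique_reduced_equilibrium \<alpha> \<beta> p \<sigma>' \<Longrightarrow> \<sigma>' = \<sigma>"
  unfolding unique_reduced_equilibrium_def by blast

definition truthfulness :: "real \<Rightarrow> (bool \<Rightarrow> bool \<Rightarrow> real) \<Rightarrow> real" where
  "truthfulness p \<sigma> = (\<Sum>\<theta>\<in>UNIV. prior p \<theta> * \<sigma> \<theta> \<theta>)"

text \<open>Negating the message exchanges lies and truths, and negating the evidence complements
  its probability, so the new detector assigns to \<open>(m, e)\<close> what the old one assigned to
  \<open>(\<not> m, \<not> e)\<close>.\<close>

lemma reduced_equilibrium_swap_messages: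
  assumes "reduced_equilibrium \<alpha> \<beta> p \<sigma> q"
  shows "reduced_equilibrium (1 - \<beta>) (1 - \<alpha>) p (\<lambda>\<theta> m. \<sigma> \<theta> (\<not> m)) (\<lambda>m e. q (\<not> m) (\<not> e))"
proof -
  have "high_action_prob (1 - \<beta>) (1 - \<alpha>) (\<lambda>m e. q (\<not> m) (\<not> e)) \<theta> m =
      high_action_prob \<alpha> \<beta> q \<theta> (\<not> m)" for \<theta> m
    by (simp add: high_action_prob_def UNIV_bool detector_def)
  moreover have "joint_prob (1 - \<beta>) (1 - \<alpha>) p (\<lambda>\<theta> m. \<sigma> \<theta> (\<not> m)) m e \<theta> =
      joint_prob \<alpha> \<beta> p \<sigma> (\<not> m) (\<not> e) \<theta>" for m e \<theta>
    by (simp add: joint_prob_def detector_def)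
  moreover have "is_dist (\<lambda>m. \<sigma> \<theta> (\<not> m)) \<longleftrightarrow> is_dist (\<sigma> \<theta>)" for \<theta>
    by (auto simp: is_dist_def UNIV_bool all_bool_eq)
  ultimately show ?thesis
    using assms unfolding reduced_equilibrium_def by (simp add: all_bool_eq)
qed

text \<open>Negating type and message together preserves whether a message is a lie, so the detector
  is unchanged. The types exchange their opposite interests, hence \<open>1 - q\<close>.\<close>

lemma reduced_equilibrium_swap_types:
  assumes "reduced_equilibrium \<alpha> \<beta> p \<sigma> q"
  shows "reduced_equilibrium \<alpha> \<beta> (1 - p) (\<lambda>\<theta> m. \<sigma> (\<not> \<theta>) (\<not> m)) (\<lambda>m e. 1 - q (\<not> m) e)"
proof -
  have "high_action_prob \<alpha> \<beta> (\<lambda>m e. 1 - q (\<not> m) e) \<theta> m =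
      1 - high_action_prob \<alpha> \<beta> q (\<not> \<theta>) (\<not> m)" for \<theta> m
    by (cases \<theta>; cases m) (simp_all add: high_action_prob_def UNIV_bool detector_def algebra_simps)
  moreover have "joint_prob \<alpha> \<beta> (1 - p) (\<lambda>\<theta> m. \<sigma> (\<not> \<theta>) (\<not> m)) m e \<theta> =
      joint_prob \<alpha> \<beta> p \<sigma> (\<not> m) e (\<not> \<theta>)" for m e \<theta>
    by (simp add: joint_prob_def detector_def prior_def)
  moreover have "is_dist (\<lambda>m. \<sigma> \<theta> (\<not> m)) \<longleftrightarrow> is_dist (\<sigma> \<theta>)" for \<theta>
    by (auto simp: is_dist_def UNIV_bool all_bool_eq)
  ultimately show ?thesis
    using assms unfolding reduced_equilibrium_def by (simp add: all_bool_eq)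
qed

text \<open>The relabelling is an involution that preserves purity, so any competitor can be carried
  back to the original game.\<close>

lemma unique_reduced_equilibrium_swap_messages:
  assumes "unique_reduced_equilibrium \<alpha> \<beta> p \<sigma>"
  shows "unique_reduced_equilibrium (1 - \<beta>) (1 - \<alpha>) p (\<lambda>\<theta> m. \<sigma> \<theta> (\<not> m))"
  unfolding unique_reduced_equilibrium_def
proof (intro conjI allI impI)
  show "\<exists>q. reduced_equilibrium (1 - \<beta>) (1 - \<alpha>) p (\<lambda>\<theta> m. \<sigma> \<theta> (\<not> m)) q"
    using assms reduced_equilibrium_swap_messages unfolding unique_reduced_equilibrium_def by blast
next
  fix \<sigma>' q
  assume *: "reduced_equilibrium (1 - \<beta>) (1 - \<alpha>) p \<sigma>' q \<and>
    (pure (\<lambda>\<theta> m. \<sigma> \<theta> (\<not> m)) \<longrightarrow> pure \<sigma>')"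
  have pure: "pure (\<lambda>\<theta> m. \<tau> \<theta> (\<not> m)) \<longleftrightarrow> pure \<tau>" for \<tau>
    by (auto simp: pure_def all_bool_eq)
  have "(\<lambda>\<theta> m. \<sigma>' \<theta> (\<not> m)) = \<sigma>"
    using assms * pure reduced_equilibrium_swap_messages[of "1 - \<beta>" "1 - \<alpha>" p \<sigma>' q]
    unfolding unique_reduced_equilibrium_def by auto
  then show "\<sigma>' = (\<lambda>\<theta> m. \<sigma> \<theta> (\<not> m))" by auto
qed

lemma unique_reduced_equilibrium_swap_types:
  assumes "unique_reduced_equilibrium \<alpha> \<beta> p \<sigma>"
  shows "unique_reduced_equilibrium \<alpha> \<beta> (1 - p) (\<lambda>\<theta> m. \<sigma> (\<not> \<theta>) (\<not> m))"
  unfolding unique_reduced_equilibrium_def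
proof (intro conjI allI impI)
  show "\<exists>q. reduced_equilibrium \<alpha> \<beta> (1 - p) (\<lambda>\<theta> m. \<sigma> (\<not> \<theta>) (\<not> m)) q"
    using assms reduced_equilibrium_swap_types unfolding unique_reduced_equilibrium_def by blast
next
  fix \<sigma>' q
  assume *: "reduced_equilibrium \<alpha> \<beta> (1 - p) \<sigma>' q \<and>
    (pure (\<lambda>\<theta> m. \<sigma> (\<not> \<theta>) (\<not> m)) \<longrightarrow> pure \<sigma>')"
  have pure: "pure (\<lambda>\<theta> m. \<tau> (\<not> \<theta>) (\<not> m)) \<longleftrightarrow> pure \<tau>" for \<tau>
    by (auto simp: pure_def all_bool_eq)
  have "(\<lambda>\<theta> m. \<sigma>' (\<not> \<theta>) (\<not> m)) = \<sigma>"
    using assms * pure reduced_equilibrium_swap_types[of \<alpha> \<beta> "1 - p" \<sigma>' q]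
    unfolding unique_reduced_equilibrium_def by auto
  then show "\<sigma>' = (\<lambda>\<theta> m. \<sigma> (\<not> \<theta>) (\<not> m))" by auto
qed

lemma truthfulness_swap_messages:
  assumes "\<And>\<theta>. is_dist (\<sigma> \<theta>)"
  shows "truthfulness p (\<lambda>\<theta> m. \<sigma> \<theta> (\<not> m)) = 1 - truthfulness p \<sigma>"
  using assms[of True] assms[of False]
  by (simp add: truthfulness_def UNIV_bool prior_def is_dist_iff left_diff_distrib right_diff_distrib)

lemma truthfulness_swap_types:
  "truthfulness (1 - p) (\<lambda>\<theta> m. \<sigma> (\<not> \<theta>) (\<not> m)) = truthfulness p \<sigma>"
  by (simp add: truthfulness_def UNIV_bool prior_def)

section \<open>Equilibria for G < 0\<close>

text \<open>Even message 1 without an alarm leaves type 0 likelier under this pooling. The other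
  pure strategies fail: pooling on message 0 by \<open>no_informative_pooling\<close>, and both
  separating ones because type 0 gains by imitating type 1.\<close>

lemma zero_heavy_unique_pooling:
  assumes \<alpha>: "0 \<le> \<alpha>" and \<alpha>\<beta>: "\<alpha> < \<beta>" "\<alpha> + \<beta> < 1"
    and p: "\<alpha> * (1 - p) < \<beta> * p" "(1 - \<alpha>) * p < (1 - \<beta>) * (1 - p)"
  shows "unique_reduced_equilibrium \<alpha> \<beta> p (\<lambda>\<theta>. prior 1)" and "2 * p < 1"
proof -
  have pos: "0 < \<beta>" "\<beta> < 1" "0 < 1 - \<beta>" "0 < 1 - \<alpha>" using \<alpha> \<alpha>\<beta> by auto
  show half: "2 * p < 1"
  proof (rule ccontr)
    assume "\<not> 2 * p < 1"
    then have "(1 - \<beta>) * (1 - p) \<le> (1 - \<beta>) * p" "(1 - \<beta>) * p \<le> (1 - \<alpha>) * p"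
      using pos \<alpha>\<beta> by (auto intro!: mult_left_mono mult_right_mono)
    then show False using p by linarith
  qed
  have p0: "0 < p"
  proof (rule ccontr)
    assume "\<not> 0 < p"
    then have "\<beta> * p \<le> 0" "0 \<le> \<alpha> * (1 - p)" using \<alpha> pos by (auto simp: mult_nonneg_nonpos)
    then show False using p by linarith
  qed
  have low: "\<alpha> * p < \<beta> * (1 - p)" "(1 - \<beta>) * p < (1 - \<alpha>) * (1 - p)"
    using half p0 \<alpha> \<alpha>\<beta> by (auto intro!: mult_strict_mono')
  \<comment> \<open>Answering action 0 off the path as well makes both types indifferent between the
    messages.\<close>
  have "reduced_equilibrium \<alpha> \<beta> p (\<lambda>\<theta>. prior 1) (\<lambda>m e. 0)"
    using p low
    by (auto simp: reduced_equilibrium_def all_bool_eq high_action_prob_def joint_prob_def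
        detector_def prior_def UNIV_bool is_dist_iff)
  moreover have "\<sigma> = (\<lambda>\<theta>. prior 1)" if "pure \<sigma>" and E: "reduced_equilibrium \<alpha> \<beta> p \<sigma> q" for \<sigma> q
  proof -
    obtain s0 s1 where s: "\<sigma> False = prior s0" "\<sigma> True = prior s1"
      using E unfolding reduced_equilibrium_def by (metis is_dist_eq_prior)
    have s01: "s0 = 0 \<or> s0 = 1" "s1 = 0 \<or> s1 = 1"
      using \<open>pure \<sigma>\<close> s by (auto simp: pure_def all_bool_eq prior_def)
    note E' = E[unfolded reduced_equilibrium_def high_action_prob_def joint_prob_def detector_def]
    have q: "0 \<le> q m e" "q m e \<le> 1" for m e using E' by auto
    have "s0 = 1 \<and> s1 = 1"
    proof (rule ccontr)
      assume "\<not> ?thesis"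
      then consider "s0 = 0" "s1 = 0" | "s0 = 0" "s1 = 1" | "s0 = 1" "s1 = 0"
        using s01 by blast
      then show False
      proof cases
        case 1
        then have "q False False = 0" "q False True = 1"
          "(1 - \<beta>) * q True False + \<beta> * q True True \<le> \<alpha>"
          "\<beta> \<le> (1 - \<alpha>) * q True False + \<alpha> * q True True"
          using E' p low by (auto simp: s all_bool_eq prior_def UNIV_bool)
        then show False
          using no_informative_pooling[OF \<alpha>\<beta> pos(2) q(1)] by blast
      next
        case 2
        then have *: "q False False = 0" "\<alpha> > 0 \<longrightarrow> q False True = 0" "q True False = 1"
          "(1 - \<beta>) * q True False + \<beta> * q True True
            \<le> (1 - \<alpha>) * q False False + \<alpha> * q False True"
          using E' p0 half pos by (auto simp: s all_bool_eq prior_def UNIV_bool)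
        moreover have "0 \<le> \<beta> * q True True" using pos q by simp
        ultimately show False using \<alpha> pos by (cases "\<alpha> = 0") auto
      next
        case 3
        then have *: "q False False = 1" "q True False = 0" "q True True = 0"
          "(1 - \<alpha>) * q False False + \<alpha> * q False True
            \<le> (1 - \<beta>) * q True False + \<beta> * q True True"
          using E' p0 half pos by (auto simp: s all_bool_eq prior_def UNIV_bool)
        moreover have "0 \<le> \<alpha> * q False True" using \<alpha> q by simp
        ultimately show False using pos by simp
      qed
    qed
    then show ?thesis using s by (auto simp: fun_eq_iff all_bool_eq)
  qed
  moreover have "pure (\<lambda>\<theta>. prior 1)" by (simp add: pure_def prior_def)
  ultimately show "unique_reduced_equilibrium \<alpha> \<beta> p (\<lambda>\<theta>. prior 1)"
    unfolding unique_reduced_equilibrium_def by blast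
qed

text \<open>The indifference conditions from \<open>middle_regime_balance\<close> are two linear
  equations with determinant \<open>a\<^sup>2 - b\<^sup>2\<close>, so they fix the strategy. The
  rate \<open>b / (a + b)\<close> is T2 under equal stakes.\<close>

lemma middle_unique_mixed:
  fixes \<alpha> \<beta> p :: real
  defines "a \<equiv> 1 - \<alpha>" and "b \<equiv> 1 - \<beta>"
  assumes \<alpha>: "0 \<le> \<alpha>" and \<alpha>\<beta>: "\<alpha> < \<beta>" "\<alpha> + \<beta> < 1" and p01: "0 \<le> p" "p \<le> 1"
    and p: "b * (1 - p) < a * p" "b * p < a * (1 - p)"
  shows "\<exists>\<sigma>. unique_reduced_equilibrium \<alpha> \<beta> p \<sigma> \<and> truthfulness p \<sigma> = b / (a + b)"
proof -
  have pos: "0 < b" "b < a" "0 < \<beta>" "\<beta> < 1" "0 < a" "a \<le> 1"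
    using \<alpha> \<alpha>\<beta> by (auto simp: a_def b_def)
  have p01: "0 < p" "p < 1"
    using p p01 pos by (smt (verit) mult_nonneg_nonneg mult_eq_0_iff)+
  \<comment> \<open>\<open>k\<close> solves the receiver's two indifference conditions for the joint probabilities
      \<open>a * k\<close> and \<open>b * k\<close> of message 1 with type 0 and type 1.\<close>
  define k where "k = (a * (1 - p) - b * p) / (a\<^sup>2 - b\<^sup>2)"
  define s0 where "s0 = a * k / (1 - p)"
  define s1 where "s1 = b * k / p"
  have d: "0 < a\<^sup>2 - b\<^sup>2" using pos by (simp add: power2_eq_square mult_strict_mono')
  have k: "0 < k" using p d by (simp add: k_def)
  have uv: "(1 - p) * s0 = a * k" "p * s1 = b * k" using p01 by (simp_all add: s0_def s1_def)
  have "k * (a\<^sup>2 - b\<^sup>2) = a * (1 - p) - b * p" using d by (simp add: k_def)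
  then have bal: "b * (p - b * k) = a * (1 - p - a * k)"
    by (simp add: power2_eq_square algebra_simps)
  \<comment> \<open>This identity makes \<open>p - b * k\<close> positive; \<open>bal\<close>
    transfers the sign to \<open>1 - p - a * k\<close>, and so \<open>s0\<close> and
    \<open>s1\<close> are below 1.\<close>
  have "b * (p - b * k) * (a\<^sup>2 - b\<^sup>2) = a * b * (a * p - b * (1 - p))"
    using arg_cong[OF \<open>k * (a\<^sup>2 - b\<^sup>2) = _\<close>, of "\<lambda>x. b * b * x"]
    by (simp add: power2_eq_square algebra_simps)
  moreover have "0 < a * b * (a * p - b * (1 - p))" using p pos by simp
  ultimately have "0 < b * (p - b * k)" using d by (metis zero_less_mult_pos2)
  then have "0 < p - b * k" "0 < 1 - p - a * k"
    using bal pos zero_less_mult_pos by metis+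
  then have lt: "b * k < p" "a * k < 1 - p" by simp_all
  have s01: "0 < s0" "s0 < 1" "0 < s1" "s1 < 1"
    using lt k pos p01 by (auto simp: s0_def s1_def)
  define \<sigma> where "\<sigma> \<theta> = prior (if \<theta> then s1 else s0)" for \<theta>
  define g where "g = 1 - \<alpha> - \<beta>"
  have g: "0 < g" using \<alpha>\<beta> by (simp add: g_def)
  \<comment> \<open>Since the receiver contradicts the message after an alarm, these mixing
      probabilities are the ones that make both types of the sender indifferent.\<close>
  define q where "q m e = (if e then if m then 0 else 1 else if m then 1 / (1 + g) else g / (1 + g))"
    for m e
  have "reduced_equilibrium \<alpha> \<beta> p \<sigma> q"
  proof -
    have q01: "0 \<le> q m e \<and> q m e \<le> 1" for m e using g by (simp add: q_def)
    have H0: "a * (g / (1 + g)) + \<alpha> = b * (1 / (1 + g))"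
      using g by (simp add: field_simps a_def b_def g_def)
    have H1: "b * (g / (1 + g)) + \<beta> = a * (1 / (1 + g))"
      using g by (simp add: field_simps a_def b_def g_def)
    have uv': "s1 * p = b * k" "s0 * (1 - p) = a * k"
      "(1 - s1) * p = p - b * k" "(1 - s0) * (1 - p) = 1 - p - a * k"
      using uv by (simp_all add: algebra_simps)
    \<comment> \<open>The right-hand side does not depend on \<open>m\<close>, so each type is
      indifferent.\<close>
    have H: "high_action_prob \<alpha> \<beta> q \<theta> m = (if \<theta> then a else b) * (1 / (1 + g))" for \<theta> m
      using H0 H1
      by (cases \<theta>; cases m)
        (simp_all add: high_action_prob_def UNIV_bool detector_def q_def add.commute flip: a_def b_def)
    \<comment> \<open>Without an alarm the receiver is indifferent; it remains that an alarm makes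
      type 0 likelier after message 1 and type 1 likelier after message 0.\<close>
    have "\<alpha> * b < \<beta> * a" using \<alpha> \<alpha>\<beta> pos by (intro mult_strict_mono') auto
    then have "\<alpha> * (b * k) < \<beta> * (a * k)" using k by (simp flip: mult.assoc)
    moreover have "\<alpha> * (1 - p - a * k) < \<beta> * (p - b * k)"
    proof -
      have "b * (1 - p - a * k) \<le> b * (p - b * k)" using bal pos lt by simp
      then have "\<alpha> * (1 - p - a * k) \<le> \<alpha> * (p - b * k)" using pos \<alpha> by (simp add: mult_left_mono)
      also have "\<dots> < \<beta> * (p - b * k)" using \<alpha>\<beta> lt by simp
      finally show ?thesis .
    qed
    moreover have "joint_prob \<alpha> \<beta> p \<sigma> m e True =
        (if e then if m then \<alpha> else \<beta> else if m then a else b) * (if m then b * k else p - b * k)"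
      "joint_prob \<alpha> \<beta> p \<sigma> m e False =
        (if e then if m then \<beta> else \<alpha> else if m then b else a) * (if m then a * k else 1 - p - a * k)"
      for m e
      by (simp_all add: joint_prob_def detector_def \<sigma>_def prior_def mult.assoc uv' flip: a_def b_def)
    moreover have "is_dist (\<sigma> \<theta>)" for \<theta>
      using s01 by (simp add: \<sigma>_def is_dist_prior)
    ultimately show ?thesis
      unfolding reduced_equilibrium_def H
      using q01 bal
      by (simp add: all_bool_eq q_def mult.left_commute[of b a])
  qed
  moreover have "\<sigma>' = \<sigma>" if E: "reduced_equilibrium \<alpha> \<beta> p \<sigma>' q'" for \<sigma>' q'
  proof -
    obtain t0 t1 where t: "\<sigma>' False = prior t0" "\<sigma>' True = prior t1"
      and t01: "0 \<le> t0" "t0 \<le> 1" "0 \<le> t1" "t1 \<le> 1"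
      using E unfolding reduced_equilibrium_def by (metis is_dist_eq_prior is_dist_iff)
    note E' = E[unfolded reduced_equilibrium_def high_action_prob_def joint_prob_def detector_def t]
    define u where "u = t1 * p"
    define v where "v = t0 * (1 - p)"
    have c: "p - u = (1 - t1) * p" "1 - p - v = (1 - t0) * (1 - p)"
      by (simp_all add: u_def v_def algebra_simps)
    have iff: "u < p \<longleftrightarrow> t1 < 1" "0 < u \<longleftrightarrow> 0 < t1" "v < 1 - p \<longleftrightarrow> t0 < 1" "0 < v \<longleftrightarrow> 0 < t0"
      using p01 by (simp_all add: u_def v_def zero_less_mult_iff)
    have uv01: "0 \<le> u" "u \<le> p" "0 \<le> v" "v \<le> 1 - p"
      using t01 p01 by (simp_all add: u_def v_def mult_left_le_one_le)
    have qb: "0 \<le> q' m e" "q' m e \<le> 1" for m e using E' by auto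
    have S: "v < 1 - p \<longrightarrow> (1 - \<beta>) * q' True False + \<beta> * q' True True
          \<le> (1 - \<alpha>) * q' False False + \<alpha> * q' False True"
      "0 < v \<longrightarrow> (1 - \<alpha>) * q' False False + \<alpha> * q' False True
          \<le> (1 - \<beta>) * q' True False + \<beta> * q' True True"
      "u < p \<longrightarrow> (1 - \<beta>) * q' False False + \<beta> * q' False True
          \<le> (1 - \<alpha>) * q' True False + \<alpha> * q' True True"
      "0 < u \<longrightarrow> (1 - \<alpha>) * q' True False + \<alpha> * q' True True
          \<le> (1 - \<beta>) * q' False False + \<beta> * q' False True"
      using E' unfolding iff by (simp_all add: all_bool_eq prior_def UNIV_bool)
    have R: "(1 - \<alpha>) * (1 - p - v) < (1 - \<beta>) * (p - u) \<longrightarrow> q' False False = 1"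
      "(1 - \<beta>) * (p - u) < (1 - \<alpha>) * (1 - p - v) \<longrightarrow> q' False False = 0"
      "\<alpha> * (1 - p - v) < \<beta> * (p - u) \<longrightarrow> q' False True = 1"
      "\<beta> * (p - u) < \<alpha> * (1 - p - v) \<longrightarrow> q' False True = 0"
      "(1 - \<beta>) * v < (1 - \<alpha>) * u \<longrightarrow> q' True False = 1"
      "(1 - \<alpha>) * u < (1 - \<beta>) * v \<longrightarrow> q' True False = 0"
      "\<beta> * v < \<alpha> * u \<longrightarrow> q' True True = 1"
      "\<alpha> * u < \<beta> * v \<longrightarrow> q' True True = 0"
      using E' unfolding c unfolding u_def v_def
      by (simp_all add: all_bool_eq prior_def mult.assoc)
    have "a * u = b * v \<and> b * (p - u) = a * (1 - p - v)"
      unfolding a_def b_def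
      by (rule middle_regime_balance[OF \<alpha> \<alpha>\<beta> p[unfolded a_def b_def] uv01 qb qb qb qb
          S[rule_format] R[rule_format]])
    then have *: "a * (p * t1) = b * ((1 - p) * t0)"
      "b * (p - p * t1) = a * (1 - p - (1 - p) * t0)"
      by (simp_all add: u_def v_def mult.commute)
    \<comment> \<open>Eliminating \<open>t1\<close> from the two equations leaves the equation that
      defines \<open>k\<close>, up to the factor \<open>a\<close>.\<close>
    have "(a\<^sup>2 - b\<^sup>2) * ((1 - p) * t0) = a * (a * ((1 - p) * t0)) - b * (b * ((1 - p) * t0))"
      by (simp add: power2_eq_square left_diff_distrib mult.assoc)
    also have "\<dots> = a * (a * ((1 - p) * t0)) - b * (a * (p * t1))"
      by (simp only: *(1))
    also have "\<dots> = a * (a * (1 - p) - b * p)"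
      using arg_cong[OF *(2), of "(*) a"] by (simp add: algebra_simps)
    finally have "(a\<^sup>2 - b\<^sup>2) * ((1 - p) * t0) = a * (a * (1 - p) - b * p)" .
    then have t0: "(1 - p) * t0 = (1 - p) * s0"
      using d unfolding uv k_def by (simp add: nonzero_eq_divide_eq mult.commute)
    moreover have "a * (p * t1) = a * (p * s1)"
      unfolding *(1) t0 uv by simp
    ultimately have "t0 = s0" "t1 = s1" using p01 pos by auto
    then show ?thesis using t by (auto simp: fun_eq_iff all_bool_eq \<sigma>_def)
  qed
  moreover have "truthfulness p \<sigma> = b / (a + b)"
  proof -
    have *: "truthfulness p \<sigma> = 1 - p - (a - b) * k"
      using uv by (simp add: truthfulness_def UNIV_bool \<sigma>_def prior_def algebra_simps)
    have "a\<^sup>2 - b\<^sup>2 = (a - b) * (a + b)"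
      by (simp add: power2_eq_square algebra_simps)
    then have "(a - b) * k = (a * (1 - p) - b * p) / (a + b)"
      using pos by (simp add: k_def)
    then show ?thesis unfolding * using pos by (simp add: field_simps)
  qed
  ultimately show ?thesis unfolding unique_reduced_equilibrium_def by blast
qed

lemma conservative_detector_truthfulness:
  assumes \<alpha>: "0 \<le> \<alpha>" and \<alpha>\<beta>: "\<alpha> < \<beta>" "\<alpha> + \<beta> < 1" and p: "0 \<le> p" "p \<le> 1"
    and regime: "\<alpha> * (1 - p) < \<beta> * p \<and> (1 - \<alpha>) * p < (1 - \<beta>) * (1 - p) \<or>
      (1 - \<beta>) * (1 - p) < (1 - \<alpha>) * p \<and> (1 - \<beta>) * p < (1 - \<alpha>) * (1 - p) \<or>
      (1 - \<alpha>) * (1 - p) < (1 - \<beta>) * p \<and> \<alpha> * p < \<beta> * (1 - p)"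
  shows "\<exists>\<sigma>. unique_reduced_equilibrium \<alpha> \<beta> p \<sigma> \<and> truthfulness p \<sigma> \<le> 1 / 2"
  using regime
proof (elim disjE conjE)
  assume *: "\<alpha> * (1 - p) < \<beta> * p" "(1 - \<alpha>) * p < (1 - \<beta>) * (1 - p)"
  show ?thesis
    using zero_heavy_unique_pooling[OF \<alpha> \<alpha>\<beta> *]
    by (intro exI[of _ "\<lambda>\<theta>. prior 1"]) (simp add: truthfulness_def UNIV_bool prior_def)
next
  assume *: "(1 - \<beta>) * (1 - p) < (1 - \<alpha>) * p" "(1 - \<beta>) * p < (1 - \<alpha>) * (1 - p)"
  have "(1 - \<beta>) / (1 - \<alpha> + (1 - \<beta>)) \<le> 1 / 2" using \<alpha> \<alpha>\<beta> by (simp add: field_simps)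
  then show ?thesis using middle_unique_mixed[OF \<alpha> \<alpha>\<beta> p *] by auto
next
  assume *: "(1 - \<alpha>) * (1 - p) < (1 - \<beta>) * p" "\<alpha> * p < \<beta> * (1 - p)"
  have "unique_reduced_equilibrium \<alpha> \<beta> (1 - p) (\<lambda>\<theta>. prior 1)" "2 * (1 - p) < 1"
    using zero_heavy_unique_pooling[OF \<alpha> \<alpha>\<beta>, of "1 - p"] * by simp_all
  then show ?thesis
    using unique_reduced_equilibrium_swap_types[of \<alpha> \<beta> "1 - p" "\<lambda>\<theta>. prior 1"]
      truthfulness_swap_types[of "1 - p" "\<lambda>\<theta>. prior 1"]
    \<comment> \<open>This strategy pools on message 0, so only type 0 is truthful and the rate is
      \<open>1 - p\<close>.\<close>
    by (intro exI[of _ "\<lambda>\<theta> m. prior 1 (\<not> m)"])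
      (simp add: truthfulness_def UNIV_bool prior_def)
qed

section \<open>Truth-induction rates for every G\<close>

lemma truth_induction_rate_eq:
  assumes "deception_utilities uS uR" and "Delta0 uR = Delta1 uR"
    and "0 \<le> alpha_of J G" "alpha_of J G \<le> beta_of J G" "beta_of J G \<le> 1" and "0 \<le> p" "p \<le> 1"
    and "unique_reduced_equilibrium (alpha_of J G) (beta_of J G) p \<sigma>"
  shows "truth_induction_rate uS uR J G p = truthfulness p \<sigma>"
proof -
  have "(THE \<sigma>. unique_sender_equilibrium (alpha_of J G) (beta_of J G) uS uR p \<sigma>) = \<sigma>"
    unfolding unique_sender_equilibrium_iff[OF assms(1-7)]
    using assms(8) unique_reduced_equilibrium_unique by blast
  then show ?thesis by (simp add: truth_induction_rate_def truthfulness_def)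
qed

text \<open>Let the receiver play action 1 exactly when message and evidence differ. As \<alpha> = 1
  - \<beta>, each type then induces action 1 equally often with either message, which supports both
  pooling strategies.\<close>

lemma neutral_detector_not_unique:
  assumes \<alpha>: "0 \<le> \<alpha>" and \<alpha>\<beta>: "\<alpha> < \<beta>" "\<alpha> + \<beta> = 1"
    and p: "\<alpha> * (1 - p) < \<beta> * p" "\<alpha> * p < \<beta> * (1 - p)"
  shows "\<not> unique_reduced_equilibrium \<alpha> \<beta> p \<sigma>"
proof
  assume U: "unique_reduced_equilibrium \<alpha> \<beta> p \<sigma>"
  have \<beta>: "\<beta> = 1 - \<alpha>" using \<alpha>\<beta> by simp
  have "reduced_equilibrium \<alpha> \<beta> p (\<lambda>\<theta>. prior (of_bool x)) (\<lambda>m e. of_bool (m \<noteq> e))" for x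
    using p by (cases x) (auto simp: \<beta> reduced_equilibrium_def all_bool_eq high_action_prob_def
        joint_prob_def detector_def prior_def UNIV_bool is_dist_iff)
  moreover have "pure (\<lambda>\<theta>. prior (of_bool x))" for x by (simp add: pure_def prior_def)
  ultimately have "(\<lambda>\<theta>. prior (of_bool x)) = \<sigma>" for x
    using U unfolding unique_reduced_equilibrium_def by blast
  from this[of True] this[of False] have "prior 1 True = prior 0 True"
    by (metis of_bool_eq(1) of_bool_eq(2))
  then show False by (simp add: prior_def)
qed

text \<open>A common stake \<open>D\<close> cancels, which turns the regime bounds into the
  cross-multiplied inequalities used above.\<close>

lemma threshold_iff:
  fixes x y D p :: real
  assumes "0 < D" "0 < x + y"
  shows "x * D / (x * D + y * D) < p \<longleftrightarrow> x * (1 - p) < y * p"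
    and "p < x * D / (x * D + y * D) \<longleftrightarrow> y * p < x * (1 - p)"
proof -
  have "x * D / (x * D + y * D) = x / (x + y)"
    using assms by (simp flip: distrib_right)
  then show "x * D / (x * D + y * D) < p \<longleftrightarrow> x * (1 - p) < y * p"
    "p < x * D / (x * D + y * D) \<longleftrightarrow> y * p < x * (1 - p)"
    using assms by (simp_all add: divide_less_eq less_divide_eq algebra_simps)
qed

theorem theorem4:
  fixes uS uR :: "bool \<Rightarrow> bool \<Rightarrow> bool \<Rightarrow> real" and J G p :: real
  assumes "deception_utilities uS uR"
    and "Delta0 uR = Delta1 uR"
    and "J \<in> {0..1}" and "0 < J" and "J \<le> 1 - \<bar>G\<bar>"
    and "p \<in> {0..1}"
    and "zero_heavy (Delta0 uR) (Delta1 uR) J G p \<or>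
         middle (Delta0 uR) (Delta1 uR) J G p \<or>
         one_heavy (Delta0 uR) (Delta1 uR) J G p"
    and "G = 0 \<Longrightarrow>
         \<exists>\<sigma>S. unique_sender_equilibrium (alpha_of J G) (beta_of J G) uS uR p \<sigma>S"
  shows "(G \<in> {-1<..0} \<longrightarrow> truth_induction_rate uS uR J G p \<le> 1 / 2) \<and>
         (G \<in> {0..<1} \<longrightarrow> truth_induction_rate uS uR J G p \<ge> 1 / 2)"
proof -
  define \<alpha> where "\<alpha> = alpha_of J G"
  define \<beta> where "\<beta> = beta_of J G"
  have G: "\<alpha> + \<beta> = 1 + G" by (simp add: \<alpha>_def \<beta>_def alpha_of_def beta_of_def field_simps)
  have ab: "0 \<le> \<alpha>" "\<alpha> < \<beta>" "\<beta> \<le> 1"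
    using assms(4,5) by (auto simp: \<alpha>_def \<beta>_def alpha_of_def beta_of_def)
  have p: "0 \<le> p" "p \<le> 1" using assms(6) by auto
  have D: "0 < Delta1 uR" using assms(1) by (simp add: Delta1_def deception_utilities_def)
  note rate = truth_induction_rate_eq[OF assms(1,2), of J G p, folded \<alpha>_def \<beta>_def,
      OF ab(1) less_imp_le[OF ab(2)] ab(3) p]
  have "0 < \<alpha> + \<beta>" "0 < \<beta> + \<alpha>" "0 < (1 - \<alpha>) + (1 - \<beta>)" "0 < (1 - \<beta>) + (1 - \<alpha>)"
    using ab by auto
  note T = this[THEN threshold_iff(1)[OF D]] this[THEN threshold_iff(2)[OF D]]
  note regime = assms(7)[unfolded zero_heavy_def middle_def one_heavy_def Let_def
      T1_def T2_def T3_def T4_def assms(2), folded \<alpha>_def \<beta>_def, unfolded T]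
  consider "G < 0" | "G = 0" | "0 < G" by linarith
  then show ?thesis
  proof cases
    case 1
    obtain \<sigma> where "unique_reduced_equilibrium \<alpha> \<beta> p \<sigma>" "truthfulness p \<sigma> \<le> 1 / 2"
      using conservative_detector_truthfulness[of \<alpha> \<beta> p] ab p G 1 regime by auto
    then show ?thesis using rate 1 by simp
  next
    case 2
    then have "\<beta> = 1 - \<alpha>" using G by simp
    \<comment> \<open>The Heavy regimes are contradictory here because T1 = T2 and T3 = T4.\<close>
    then have "\<alpha> * (1 - p) < \<beta> * p" "\<alpha> * p < \<beta> * (1 - p)"
      using regime by auto
    then have "\<not> unique_sender_equilibrium \<alpha> \<beta> uS uR p \<sigma>" for \<sigma>
      using neutral_detector_not_unique[of \<alpha> \<beta> p] ab G 2
        unique_sender_equilibrium_iff[OF assms(1,2) ab(1) less_imp_le[OF ab(2)] ab(3) p]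
      by auto
    then show ?thesis using assms(8)[OF 2] unfolding \<alpha>_def \<beta>_def by blast
  next
    case 3
    \<comment> \<open>The mirrored detector has
      \<open>(1 - \<beta>) + (1 - \<alpha>) = 1 - G < 1\<close>, and mirroring exchanges T1 with T2
      and T3 with T4, so each regime is kept.\<close>
    obtain \<sigma> where \<sigma>: "unique_reduced_equilibrium (1 - \<beta>) (1 - \<alpha>) p \<sigma>"
        "truthfulness p \<sigma> \<le> 1 / 2"
      using conservative_detector_truthfulness[of "1 - \<beta>" "1 - \<alpha>" p] ab p G 3 regime by auto
    have "\<And>\<theta>. is_dist (\<sigma> \<theta>)"
      using \<sigma>(1) unfolding unique_reduced_equilibrium_def reduced_equilibrium_def by blast
    then have "truthfulness p (\<lambda>\<theta> m. \<sigma> \<theta> (\<not> m)) \<ge> 1 / 2"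
      using \<sigma>(2) by (simp add: truthfulness_swap_messages)
    then show ?thesis
      using rate[OF unique_reduced_equilibrium_swap_messages[OF \<sigma>(1), simplified]] 3 by simp
  qed
qed

end
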